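(* Let $A$ be the circulant matrix generated by a vector $a=(a_j)_{j\in\{0,\dots,N-1\}}\in\mathbb{R}^N$, and let $\phi_l=\frac{2\pi l}{N}$. Then, for any $c\in\mathbb{S}$ and any $q\in\mathbb{Z}$, the state defined by $$\theta_j(t)=\frac{2\pi jq}{N}+\omega_qt+c,\qquad j\in\{1,\dots,N\},\qquad\text{where }\ \omega_q:=\sum_{l=1}^{N-1}a_l\sin(q\phi_l),$$ is a solution to the Kuramoto model $$\frac{d}{dt}\theta_j=\sum_{l=1}^N A_{jl}\sin(\theta_l-\theta_j),\qquad j\in\{1,\dots,N\}.$$ (The case $q=0$ corresponds to a synchronized state, with angular velocity $\omega_0=0$, while the case $q\ne0$ defines a $q$-rotational twisted state.)
   Context: $\mathbb{S}=\mathbb{R}/2\pi\mathbb{Z}$. A matrix $A\in M_N(\mathbb{R})$ is circulant, generated by $a=(a_0,\dots,a_{N-1})$, if $A_{jl}=a_{(l-j)\bmod N}$ for all $j,l\in\{1,\dots,N\}$, with remainder in $\{0,\dots,N-1\}$. A synchronized state is one with all $\theta_j(t)$ equal to a common value; a $q$-rotational twisted state is one of the form $\theta_j(t)=\frac{2\pi jq}{N}+\theta(t)$ with $\frac{d}{dt}\theta$ equal to a constant. *)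

theory Defs
  imports Complex_Main
begin

definition angle_rel :: "real \<Rightarrow> real \<Rightarrow> bool" where
  "angle_rel x y \<longleftrightarrow> (\<exists>k::int. x - y = 2 * pi * of_int k)"

lemma equivp_angle_rel: "equivp angle_rel"
proof (rule equivpI)
  show "reflp angle_rel"
    by (rule reflpI) (auto simp: angle_rel_def intro: exI[of _ 0])
  show "symp angle_rel"
  proof (rule sympI)
    fix x y assume "angle_rel x y"
    then obtain k :: int where "x - y = 2 * pi * of_int k"
      by (auto simp: angle_rel_def)
    then have "y - x = 2 * pi * of_int (- k)" by simp
    then show "angle_rel y x" unfolding angle_rel_def by blast
  qed
  show "transp angle_rel"
  proof (rule transpI)
    fix x y z assume "angle_rel x y" "angle_rel y z"
    then obtain k l :: int where "x - y = 2 * pi * of_int k" "y - z = 2 * pi * of_int l"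
      by (auto simp: angle_rel_def)
    then have "x - z = 2 * pi * of_int (k + l)" by (simp add: algebra_simps)
    then show "angle_rel x z" unfolding angle_rel_def by blast
  qed
qed

quotient_type circle = real / angle_rel
  by (rule equivp_angle_rel)

lift_definition circle_of :: "real \<Rightarrow> circle" is "\<lambda>x. x" .

instantiation circle :: ab_group_add
begin

lift_definition zero_circle :: circle is 0 .

lift_definition plus_circle :: "circle \<Rightarrow> circle \<Rightarrow> circle" is "(+)"
proof -
  fix x x' y y' assume "angle_rel x x'" "angle_rel y y'"
  then obtain k l :: int where "x - x' = 2 * pi * of_int k" "y - y' = 2 * pi * of_int l"
    by (auto simp: angle_rel_def)
  then have "(x + y) - (x' + y') = 2 * pi * of_int (k + l)" by (simp add: algebra_simps)
  then show "angle_rel (x + y) (x' + y')" unfolding angle_rel_def by blast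
qed

lift_definition uminus_circle :: "circle \<Rightarrow> circle" is uminus
proof -
  fix x x' assume "angle_rel x x'"
  then obtain k :: int where "x - x' = 2 * pi * of_int k"
    by (auto simp: angle_rel_def)
  then have "- x - - x' = 2 * pi * of_int (- k)" by simp
  then show "angle_rel (- x) (- x')" unfolding angle_rel_def by blast
qed

definition minus_circle :: "circle \<Rightarrow> circle \<Rightarrow> circle" where
  "minus_circle x y = x + - y"

instance
proof
  fix a b c :: circle
  show "a + b + c = a + (b + c)"
    by transfer (simp add: equivp_reflp[OF equivp_angle_rel] add.assoc)
  show "a + b = b + a"
    by transfer (simp add: equivp_reflp[OF equivp_angle_rel] add.commute)
  show "0 + a = a"
    by transfer (simp add: equivp_reflp[OF equivp_angle_rel])
  show "- a + a = 0"
    by transfer (simp add: equivp_reflp[OF equivp_angle_rel])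
  show "a - b = a + - b"
    by (rule minus_circle_def)
qed

end

lift_definition sin_circle :: "circle \<Rightarrow> real" is sin
proof -
  fix x y assume "angle_rel x y"
  then obtain k :: int where "x - y = 2 * pi * of_int k"
    by (auto simp: angle_rel_def)
  then have "x = y + 2 * pi * of_int k" by simp
  then show "sin x = sin y"
    by (simp add: sin_add sin_int_2pin cos_int_2pin)
qed

(* Derivative at t of a curve in the circle: the derivative of a real-valued lift near t.
   By has_circle_derivative_unique it does not depend on the lift. *)
definition has_circle_derivative :: "(real \<Rightarrow> circle) \<Rightarrow> real \<Rightarrow> real \<Rightarrow> bool" where
  "has_circle_derivative f v t \<longleftrightarrow>
     (\<exists>g. (\<forall>\<^sub>F s in nhds t. f s = circle_of (g s)) \<and> (g has_real_derivative v) (at t))"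

lemma circle_of_eq_iff: "circle_of x = circle_of y \<longleftrightarrow> (\<exists>k::int. x - y = 2 * pi * of_int k)"
  by transfer (simp add: angle_rel_def)

lemma has_circle_derivative_unique:
  assumes "has_circle_derivative f v t" "has_circle_derivative f w t"
  shows "v = w"
proof -
  obtain g where g: "\<forall>\<^sub>F s in nhds t. f s = circle_of (g s)" "(g has_real_derivative v) (at t)"
    using assms(1) by (auto simp: has_circle_derivative_def)
  obtain h where h: "\<forall>\<^sub>F s in nhds t. f s = circle_of (h s)" "(h has_real_derivative w) (at t)"
    using assms(2) by (auto simp: has_circle_derivative_def)
  define d where "d s = g s - h s" for s
  have der: "(d has_real_derivative (v - w)) (at t)"
    unfolding d_def by (intro DERIV_diff g h)
  have ev: "\<forall>\<^sub>F s in nhds t. \<exists>k::int. d s = 2 * pi * of_int k"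
    using g(1) h(1) by eventually_elim (simp add: d_def flip: circle_of_eq_iff)
  obtain k0 :: int where k0: "d t = 2 * pi * of_int k0"
    using eventually_nhds_x_imp_x[OF ev] by blast
  have "isCont d t" using der by (rule DERIV_isCont)
  then have "filterlim d (nhds (d t)) (nhds t)"
    unfolding isCont_def using tendsto_at_iff_tendsto_nhds by blast
  then have "\<forall>\<^sub>F s in nhds t. dist (d s) (d t) < 2 * pi"
    by (rule tendstoD) simp
  with ev have "\<forall>\<^sub>F s in nhds t. d s = d t"
  proof eventually_elim
    case (elim s)
    then obtain k :: int where k: "d s = 2 * pi * of_int k" by blast
    have "d s - d t = 2 * pi * of_int (k - k0)" using k k0 by (simp add: algebra_simps)
    then have "2 * pi * \<bar>of_int (k - k0)\<bar> < 2 * pi * (1::real)"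
      using elim(2) by (simp add: dist_real_def abs_mult)
    then have "\<bar>real_of_int (k - k0)\<bar> < 1" by (subst (asm) mult_less_cancel_left_pos) auto
    then have "k = k0" by linarith
    then show ?case using k k0 by simp
  qed
  then have "(d has_real_derivative 0) (at t) = ((\<lambda>_. d t) has_real_derivative 0) (at t)"
    by (intro DERIV_cong_ev) auto
  then have "(d has_real_derivative 0) (at t)" by simp
  with der show ?thesis using DERIV_unique by fastforce
qed

(* Matrices in M_N(R) and vectors in R^N are functions whose values outside the
   index ranges {1..N} and {0..N-1}, respectively, are irrelevant. *)
definition circulant_generated_by :: "nat \<Rightarrow> (nat \<Rightarrow> nat \<Rightarrow> real) \<Rightarrow> (nat \<Rightarrow> real) \<Rightarrow> bool" where
  "circulant_generated_by N A a \<longleftrightarrow>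
     (\<forall>j\<in>{1..N}. \<forall>l\<in>{1..N}. A j l = a (nat ((int l - int j) mod int N)))"

definition kuramoto_solution :: "nat \<Rightarrow> (nat \<Rightarrow> nat \<Rightarrow> real) \<Rightarrow> (nat \<Rightarrow> real \<Rightarrow> circle) \<Rightarrow> bool" where
  "kuramoto_solution N A \<theta> \<longleftrightarrow>
     (\<forall>t. \<forall>j\<in>{1..N}.
        has_circle_derivative (\<theta> j) (\<Sum>l=1..N. A j l * sin_circle (\<theta> l t - \<theta> j t)) t)"

definition synchronized_state :: "nat \<Rightarrow> (nat \<Rightarrow> real \<Rightarrow> circle) \<Rightarrow> bool" where
  "synchronized_state N \<theta> \<longleftrightarrow> (\<forall>t. \<exists>x. \<forall>j\<in>{1..N}. \<theta> j t = x)"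

definition twisted_state :: "nat \<Rightarrow> int \<Rightarrow> (nat \<Rightarrow> real \<Rightarrow> circle) \<Rightarrow> bool" where
  "twisted_state N q \<theta> \<longleftrightarrow>
     (\<exists>\<psi> v. (\<forall>t. \<forall>j\<in>{1..N}.
                \<theta> j t = circle_of (2 * pi * real j * real_of_int q / real N) + \<psi> t)
            \<and> (\<forall>t. has_circle_derivative \<psi> v t))"

definition phi :: "nat \<Rightarrow> nat \<Rightarrow> real" where
  "phi N l = 2 * pi * real l / real N"

definition omega :: "nat \<Rightarrow> (nat \<Rightarrow> real) \<Rightarrow> int \<Rightarrow> real" where
  "omega N a q = (\<Sum>l=1..N - 1. a l * sin (real_of_int q * phi N l))"

definition rotating_state :: "nat \<Rightarrow> (nat \<Rightarrow> real) \<Rightarrow> int \<Rightarrow> circle \<Rightarrow> nat \<Rightarrow> real \<Rightarrow> circle" where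
  "rotating_state N a q c j t =
     circle_of (2 * pi * real j * real_of_int q / real N + omega N a q * t) + c"

end

theory Submission imports Defs begin

text \<open>
  The phase differences of a rotating state are constant in time, since all oscillators share
  the drift \<open>\<omega>\<^sub>q t\<close>: the difference of oscillators \<open>l\<close> and \<open>j\<close> is \<open>q (l - j) 2\<pi> / N\<close>. This angle,
  like the entry \<open>A\<^sub>j\<^sub>l\<close> of the circulant matrix, depends only on \<open>l - j\<close> modulo \<open>N\<close>, because
  changing \<open>l - j\<close> by a multiple of \<open>N\<close> changes the angle by a multiple of \<open>2\<pi>\<close> (\<open>q\<close> being an
  integer). For fixed \<open>j\<close> the residue of \<open>l - j\<close> runs through \<open>0, \<dots>, N - 1\<close> exactly once as
  \<open>l\<close> runs through \<open>1, \<dots>, N\<close>, so the coupling term is the same sum for every \<open>j\<close>. The residue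
  \<open>0\<close> contributes \<open>sin 0 = 0\<close>, and what remains is \<open>\<omega>\<^sub>q\<close>, which is also the angular velocity of
  each oscillator.
\<close>

lemma circle_of_add: "circle_of x + circle_of y = circle_of (x + y)"
  by transfer (simp add: equivp_reflp[OF equivp_angle_rel])

lemma circle_of_diff: "circle_of x - circle_of y = circle_of (x - y)"
  unfolding minus_circle_def
  by transfer (simp add: equivp_reflp[OF equivp_angle_rel])

lemma sin_circle_of: "sin_circle (circle_of x) = sin x"
  by transfer simp

lemma circle_of_surj: obtains x where "c = circle_of x"
proof -
  have "\<exists>x. c = circle_of x"
    by transfer (metis equivp_reflp[OF equivp_angle_rel])
  then show ?thesis using that by blast
qed

lemma has_circle_derivative_uniform_rotation:
  "has_circle_derivative (\<lambda>s. circle_of (x + w * s) + c) w t"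
proof -
  obtain y where y: "c = circle_of y" by (rule circle_of_surj)
  show ?thesis
    unfolding has_circle_derivative_def
  proof (intro exI conjI)
    show "\<forall>\<^sub>F s in nhds t. circle_of (x + w * s) + c = circle_of (x + w * s + y)"
      by (simp add: y circle_of_add)
    show "((\<lambda>s. x + w * s + y) has_real_derivative w) (at t)"
      by (auto intro!: derivative_eq_intros)
  qed
qed

text \<open>
  The indices \<open>1, \<dots>, N\<close> form a complete residue system modulo \<open>N\<close>, and translating it by \<open>- j\<close>
  gives another one.
\<close>
lemma bij_betw_shifted_residue:
  assumes "N \<ge> 1"
  shows "bij_betw (\<lambda>l. nat ((int l - int j) mod int N)) {1..N} {..<N}"
proof -
  let ?r = "\<lambda>l. nat ((int l - int j) mod int N)"
  have inj: "inj_on ?r {1..N}"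
  proof (rule inj_onI)
    fix l l' assume l: "l \<in> {1..N}" "l' \<in> {1..N}" and "?r l = ?r l'"
    then have "(int l - int j) mod int N = (int l' - int j) mod int N"
      using assms by (simp add: eq_nat_nat_iff)
    then have "int N dvd (int l - int j) - (int l' - int j)"
      by (simp only: mod_eq_dvd_iff)
    then have "int N dvd int l - int l'" by simp
    moreover have "\<bar>int l - int l'\<bar> < \<bar>int N\<bar>" using l by auto
    ultimately show "l = l'"
      using dvd_imp_le_int[of "int l - int l'" "int N"] by linarith
  qed
  have "?r ` {1..N} \<subseteq> {..<N}"
    using assms by (auto simp: nat_less_iff)
  then have "?r ` {1..N} = {..<N}"
    by (rule card_subset_eq[OF finite_lessThan]) (simp only: card_image[OF inj], simp)
  with inj show ?thesis by (simp add: bij_betw_def)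
qed

text \<open>
  Replacing an index difference \<open>d\<close> by its residue modulo \<open>N\<close> removes \<open>q (d div N)\<close> full turns
  from the angle.
\<close>
lemma sin_phi_residue:
  assumes "N \<ge> 1"
  shows "sin (of_int q * phi N (nat (d mod int N))) = sin (2 * pi * of_int d * of_int q / real N)"
proof -
  let ?k = "nat (d mod int N)" and ?m = "q * (d div int N)"
  have "d = int N * (d div int N) + int ?k"
    using assms by simp
  then have "real_of_int d = of_int (int N * (d div int N) + int ?k)"
    by (rule arg_cong)
  then have "real_of_int d = real N * of_int (d div int N) + real ?k"
    by (simp only: of_int_add of_int_mult of_int_of_nat_eq)
  then have "2 * pi * of_int d * of_int q / real N = of_int q * phi N ?k + 2 * pi * of_int ?m"
    using assms by (simp add: phi_def field_simps)
  then show ?thesis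
    by (simp only: sin_add sin_int_2pin cos_int_2pin)
qed

lemma rotating_state_diff:
  "rotating_state N a q c l t - rotating_state N a q c j t
     = circle_of (2 * pi * of_int (int l - int j) * of_int q / real N)"
  unfolding rotating_state_def
  by (simp add: circle_of_diff algebra_simps diff_divide_distrib)

lemma has_circle_derivative_rotating_state:
  "has_circle_derivative (rotating_state N a q c j) (omega N a q) t"
  unfolding rotating_state_def by (rule has_circle_derivative_uniform_rotation)

text \<open>
  The sum over oscillators \<open>l\<close> becomes the sum over residues of \<open>l - j\<close>, which no longer
  involves \<open>j\<close>; dropping the vanishing residue \<open>0\<close> turns it into \<open>\<omega>\<^sub>q\<close>.
\<close>
lemma circulant_coupling_eq_omega:
  assumes "N \<ge> 1" and "circulant_generated_by N A a" and "j \<in> {1..N}"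
  shows "(\<Sum>l=1..N. A j l * sin_circle (rotating_state N a q c l t - rotating_state N a q c j t))
           = omega N a q"
proof -
  let ?g = "\<lambda>k. a k * sin (of_int q * phi N k)"
  have "(\<Sum>l=1..N. A j l * sin_circle (rotating_state N a q c l t - rotating_state N a q c j t))
      = (\<Sum>l=1..N. ?g (nat ((int l - int j) mod int N)))"
  proof (rule sum.cong[OF refl])
    fix l assume "l \<in> {1..N}"
    with assms(2,3) have "A j l = a (nat ((int l - int j) mod int N))"
      unfolding circulant_generated_by_def by blast
    then show "A j l * sin_circle (rotating_state N a q c l t - rotating_state N a q c j t)
        = ?g (nat ((int l - int j) mod int N))"
      by (simp only: rotating_state_diff sin_circle_of sin_phi_residue[OF assms(1)])
  qed
  also have "\<dots> = (\<Sum>k<N. ?g k)"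
    by (rule sum.reindex_bij_betw[OF bij_betw_shifted_residue[OF assms(1)]])
  also have "\<dots> = omega N a q"
    unfolding omega_def using assms(1)
    by (intro sum.mono_neutral_right) (auto simp: phi_def Suc_le_eq)
  finally show ?thesis .
qed

theorem proposition3p1:
  fixes N :: nat and A :: "nat \<Rightarrow> nat \<Rightarrow> real" and a :: "nat \<Rightarrow> real"
    and c :: circle and q :: int
  assumes "N \<ge> 1"
    and "circulant_generated_by N A a"
  shows "kuramoto_solution N A (rotating_state N a q c)
    \<and> (q = 0 \<longrightarrow> synchronized_state N (rotating_state N a q c)
          \<and> omega N a 0 = 0
          \<and> (\<forall>j\<in>{1..N}. \<forall>t. has_circle_derivative (rotating_state N a q c j) (omega N a 0) t))
    \<and> (q \<noteq> 0 \<longrightarrow> twisted_state N q (rotating_state N a q c))"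
proof (intro conjI impI)
  show "kuramoto_solution N A (rotating_state N a q c)"
    unfolding kuramoto_solution_def
    using circulant_coupling_eq_omega[OF assms] has_circle_derivative_rotating_state by simp
next
  assume "q = 0"
  then show "synchronized_state N (rotating_state N a q c)"
    by (auto simp: synchronized_state_def rotating_state_def)
next
  show "omega N a 0 = 0" by (simp add: omega_def)
next
  assume "q = 0"
  then show "\<forall>j\<in>{1..N}. \<forall>t. has_circle_derivative (rotating_state N a q c j) (omega N a 0) t"
    using has_circle_derivative_rotating_state by blast
next
  let ?\<psi> = "\<lambda>t. circle_of (omega N a q * t) + c"
  have "has_circle_derivative ?\<psi> (omega N a q) t" for t
    using has_circle_derivative_uniform_rotation[where x = 0] by simp
  moreover have "rotating_state N a q c j t
      = circle_of (2 * pi * real j * real_of_int q / real N) + ?\<psi> t" for j t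
    by (simp add: rotating_state_def add.assoc flip: circle_of_add)
  ultimately show "twisted_state N q (rotating_state N a q c)"
    unfolding twisted_state_def by (intro exI[of _ ?\<psi>] exI[of _ "omega N a q"] conjI allI ballI)
qed

end
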